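(* In the setting described in the context, the activity coefficients are unique with respect to rescaling: if $c:(0,\rho_{\max})\to(0,\infty)$ is a differentiable function with $\lim_{\rho\to0^+}c(\rho)=1$ such that both the chemical potentials $\mu_A,\mu_{A_2}$ with activity coefficients $\gamma_A,\gamma_{A_2}$ and the rescaled chemical potentials $\mu_A^+,\mu_{A_2}^+$ with activity coefficients $\gamma'_A=\gamma_A\,c^{1/2}$, $\gamma'_{A_2}=\gamma_{A_2}\,c$ satisfy the Gibbs-Duhem condition on $(0,\rho_{\max})$, then $c(\rho)=1$ for all $\rho\in(0,\rho_{\max})$.
   Context: Consider the reaction $2A\rightleftharpoons A_2$ at fixed temperature $T>0$, with gas constant $R>0$. All quantities are functions of the system density $\rho\in(0,\rho_{\max})$: $x_A(\rho),x_{A_2}(\rho)>0$ are the species concentrations (number densities) and $\gamma_A(\rho),\gamma_{A_2}(\rho)>0$ the activity coefficients, all differentiable. For $p\in\{A,A_2\}$ the chemical potentials are $\mu_p=\mu_p^*+RT\ln(x_p\gamma_p)$ and the rescaled ones are $\mu_p^+=\mu_p^*+RT\ln(x_p\gamma'_p)$, with the same standard chemical potentials $\mu_p^*$ (independent of $\rho$), where $\gamma'_A=\gamma_A c^{1/2}$ and $\gamma'_{A_2}=\gamma_{A_2}c$. The Gibbs-Duhem condition for a set of potentials $\nu_A,\nu_{A_2}$ is $x_A\,d\nu_A+x_{A_2}\,d\nu_{A_2}=0$, i.e. $x_A(\rho)\nu_A'(\rho)+x_{A_2}(\rho)\nu_{A_2}'(\rho)=0$ for all $\rho\in(0,\rho_{\max})$.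 All activity coefficients (and rescaled ones) tend to $1$ as $\rho\to0$. *)

theory Defs
  imports "HOL-Analysis.Analysis"
begin

text \<open>
  Concentrations, activity coefficients and potentials are functions of the system density
  \<open>\<rho>\<close>, given as total functions on the reals; only their values on the open interval
  \<open>(0, \<rho>max)\<close> are meaningful. The standard potential \<open>\<mu>s\<close> does not depend on \<open>\<rho>\<close>.
\<close>

definition chemical_potential ::
  "real \<Rightarrow> real \<Rightarrow> real \<Rightarrow> (real \<Rightarrow> real) \<Rightarrow> (real \<Rightarrow> real) \<Rightarrow> real \<Rightarrow> real" where
  "chemical_potential R T \<mu>s x \<gamma> = (\<lambda>\<rho>. \<mu>s + R * T * ln (x \<rho> * \<gamma> \<rho>))"

definition gibbs_duhem ::
  "real \<Rightarrow> (real \<Rightarrow> real) \<Rightarrow> (real \<Rightarrow> real) \<Rightarrow> (real \<Rightarrow> real) \<Rightarrow> (real \<Rightarrow> real) \<Rightarrow> bool" where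
  "gibbs_duhem \<rho>max xA xA2 \<nu>A \<nu>A2 \<longleftrightarrow>
     (\<forall>\<rho>\<in>{0<..<\<rho>max}. xA \<rho> * deriv \<nu>A \<rho> + xA2 \<rho> * deriv \<nu>A2 \<rho> = 0)"

text \<open>
  The exponents \<open>1/2\<close> and \<open>1\<close> of \<open>c\<close> leave the equilibrium quotient
  \<open>xA2 \<gamma>A2 / (xA \<gamma>A)\<^sup>2\<close> of the reaction \<open>2A \<rightleftharpoons> A2\<close> unchanged.
\<close>

definition rescaled_A :: "(real \<Rightarrow> real) \<Rightarrow> (real \<Rightarrow> real) \<Rightarrow> real \<Rightarrow> real" where
  "rescaled_A c \<gamma>A = (\<lambda>\<rho>. \<gamma>A \<rho> * c \<rho> powr (1/2))"

definition rescaled_A2 :: "(real \<Rightarrow> real) \<Rightarrow> (real \<Rightarrow> real) \<Rightarrow> real \<Rightarrow> real" where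
  "rescaled_A2 c \<gamma>A2 = (\<lambda>\<rho>. \<gamma>A2 \<rho> * c \<rho>)"

end

theory Submission
  imports Defs
begin

text \<open>
  Rescaling by \<open>c\<^sup>k\<close> adds \<open>k R T ln c\<close> to a potential, so the difference of the two Gibbs--Duhem
  conditions is \<open>(xA / 2 + xA2) R T c' / c = 0\<close>. Since the concentrations are positive, \<open>c' = 0\<close>;
  hence \<open>c\<close> is constant, and the constant is its limit at \<open>0\<close>.
\<close>

text \<open>\<open>gibbs_duhem\<close> is phrased with \<open>deriv\<close>, which obeys the sum
  rule only where the derivative exists. Positivity of \<open>x\<close> and \<open>\<gamma>\<close>
  at \<open>\<rho>\<close> keeps the argument of \<open>ln\<close> where \<open>ln\<close> is
  differentiable.\<close>

lemma chemical_potential_differentiable: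
  assumes "x differentiable at \<rho>" and "\<gamma> differentiable at \<rho>"
    and "x \<rho> > 0" and "\<gamma> \<rho> > 0"
  shows "chemical_potential R T \<mu>s x \<gamma> field_differentiable at \<rho>"
proof -
  obtain x' \<gamma>' where "(x has_real_derivative x') (at \<rho>)" "(\<gamma> has_real_derivative \<gamma>') (at \<rho>)"
    using assms(1,2) by (auto simp: real_differentiable_def)
  then have "(chemical_potential R T \<mu>s x \<gamma> has_real_derivative
      R * T * ((x' * \<gamma> \<rho> + \<gamma>' * x \<rho>) / (x \<rho> * \<gamma> \<rho>))) (at \<rho>)"
    unfolding chemical_potential_def using assms(3,4)
    by (auto intro!: derivative_eq_intros)
  then show ?thesis
    unfolding field_differentiable_def by blast
qed

text \<open>By positivity,
  \<open>ln (x * \<gamma> * c powr k) = ln (x * \<gamma>) + k * ln c\<close> on \<open>S\<close>.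
  The exponent \<open>k\<close> is left general so that both species are instances, and
  \<open>g\<close> is fixed only on \<open>S\<close> because \<open>rescaled_A2\<close> contains
  \<open>c\<close> instead of \<open>c powr 1\<close>.\<close>

lemma deriv_chemical_potential_rescaled:
  assumes "chemical_potential R T \<mu>s x \<gamma> field_differentiable at \<rho>"
    and c: "(c has_real_derivative c') (at \<rho>)"
    and S: "open S" "\<rho> \<in> S"
    and pos: "\<And>t. t \<in> S \<Longrightarrow> x t > 0" "\<And>t. t \<in> S \<Longrightarrow> \<gamma> t > 0" "\<And>t. t \<in> S \<Longrightarrow> c t > 0"
    and g: "\<And>t. t \<in> S \<Longrightarrow> g t = \<gamma> t * c t powr k"
  shows "deriv (chemical_potential R T \<mu>s x g) \<rho> =
    deriv (chemical_potential R T \<mu>s x \<gamma>) \<rho> + R * T * k * (c' / c \<rho>)"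
proof -
  let ?\<mu> = "chemical_potential R T \<mu>s x \<gamma>"
  have "(?\<mu> has_real_derivative deriv ?\<mu> \<rho>) (at \<rho>)"
    using assms(1) DERIV_deriv_iff_field_differentiable by blast
  then have "((\<lambda>t. ?\<mu> t + R * T * k * ln (c t)) has_real_derivative
      deriv ?\<mu> \<rho> + R * T * k * (c' / c \<rho>)) (at \<rho>)"
    using c pos(3)[OF S(2)] by (auto intro!: derivative_eq_intros)
  moreover have "?\<mu> t + R * T * k * ln (c t) = chemical_potential R T \<mu>s x g t" if "t \<in> S" for t
    using pos[OF that] g[OF that]
    by (simp add: chemical_potential_def ln_mult algebra_simps)
  \<comment> \<open>The two functions are known to agree only on \<open>S\<close>; as
    \<open>S\<close> is an open neighbourhood of \<open>\<rho>\<close>, this suffices to transfer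
    the derivative.\<close>
  ultimately have "(chemical_potential R T \<mu>s x g has_real_derivative
      deriv ?\<mu> \<rho> + R * T * k * (c' / c \<rho>)) (at \<rho>)"
    using has_field_derivative_transform_within_open S by blast
  then show ?thesis
    by (rule DERIV_imp_deriv)
qed

theorem corollary3:
  fixes R T \<rho>max \<mu>sA \<mu>sA2 :: real
    and xA xA2 \<gamma>A \<gamma>A2 c :: "real \<Rightarrow> real"
  assumes "R > 0" and "T > 0" and "\<rho>max > 0"
    and "\<And>\<rho>. \<rho> \<in> {0<..<\<rho>max} \<Longrightarrow> xA \<rho> > 0"
    and "\<And>\<rho>. \<rho> \<in> {0<..<\<rho>max} \<Longrightarrow> xA2 \<rho> > 0"
    and "\<And>\<rho>. \<rho> \<in> {0<..<\<rho>max} \<Longrightarrow> \<gamma>A \<rho> > 0"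
    and "\<And>\<rho>. \<rho> \<in> {0<..<\<rho>max} \<Longrightarrow> \<gamma>A2 \<rho> > 0"
    and "xA differentiable_on {0<..<\<rho>max}"
    and "xA2 differentiable_on {0<..<\<rho>max}"
    and "\<gamma>A differentiable_on {0<..<\<rho>max}"
    and "\<gamma>A2 differentiable_on {0<..<\<rho>max}"
    and "(\<gamma>A \<longlongrightarrow> 1) (at_right 0)"
    and "(\<gamma>A2 \<longlongrightarrow> 1) (at_right 0)"
    and "(rescaled_A c \<gamma>A \<longlongrightarrow> 1) (at_right 0)"
    and "(rescaled_A2 c \<gamma>A2 \<longlongrightarrow> 1) (at_right 0)"
    and "\<And>\<rho>. \<rho> \<in> {0<..<\<rho>max} \<Longrightarrow> c \<rho> > 0"
    and "c differentiable_on {0<..<\<rho>max}"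
    and "(c \<longlongrightarrow> 1) (at_right 0)"
    and "gibbs_duhem \<rho>max xA xA2
           (chemical_potential R T \<mu>sA xA \<gamma>A)
           (chemical_potential R T \<mu>sA2 xA2 \<gamma>A2)"
    and "gibbs_duhem \<rho>max xA xA2
           (chemical_potential R T \<mu>sA xA (rescaled_A c \<gamma>A))
           (chemical_potential R T \<mu>sA2 xA2 (rescaled_A2 c \<gamma>A2))"
  shows "\<forall>\<rho>\<in>{0<..<\<rho>max}. c \<rho> = 1"
proof -
  let ?I = "{0<..<\<rho>max}"
  note pos = assms(4-7) and c_pos = assms(16)
  have c_const: "(c has_real_derivative 0) (at \<rho>)" if \<rho>: "\<rho> \<in> ?I" for \<rho>
  proof -
    have diff: "f differentiable at \<rho>" if "f differentiable_on ?I" for f :: "real \<Rightarrow> real"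
      using that \<rho> by (simp add: differentiable_on_eq_differentiable_at)
    obtain c' where c': "(c has_real_derivative c') (at \<rho>)"
      using diff[OF assms(17)] by (auto simp: real_differentiable_def)
    let ?\<mu>A = "chemical_potential R T \<mu>sA xA" and ?\<mu>A2 = "chemical_potential R T \<mu>sA2 xA2"
    have "deriv (?\<mu>A (rescaled_A c \<gamma>A)) \<rho> = deriv (?\<mu>A \<gamma>A) \<rho> + R * T * (1/2) * (c' / c \<rho>)"
      using \<rho> pos c_pos diff assms(8,10)
      by (intro deriv_chemical_potential_rescaled[OF _ c', where S = ?I]
            chemical_potential_differentiable) (auto simp: rescaled_A_def)
    moreover
    \<comment> \<open>The case \<open>k = 1\<close>: the factor 1 is written out to match the lemma,
      and \<open>c powr 1 = c\<close> uses that \<open>c\<close> is nonnegative on the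
      interval.\<close>
    have "deriv (?\<mu>A2 (rescaled_A2 c \<gamma>A2)) \<rho> = deriv (?\<mu>A2 \<gamma>A2) \<rho> + R * T * 1 * (c' / c \<rho>)"
      using \<rho> pos c_pos diff assms(9,11)
      by (intro deriv_chemical_potential_rescaled[OF _ c', where S = ?I]
            chemical_potential_differentiable) (auto simp: rescaled_A2_def less_imp_le)
    moreover have "xA \<rho> * deriv (?\<mu>A \<gamma>A) \<rho> + xA2 \<rho> * deriv (?\<mu>A2 \<gamma>A2) \<rho> = 0"
      and "xA \<rho> * deriv (?\<mu>A (rescaled_A c \<gamma>A)) \<rho>
        + xA2 \<rho> * deriv (?\<mu>A2 (rescaled_A2 c \<gamma>A2)) \<rho> = 0"
      using assms(19,20) \<rho> by (auto simp: gibbs_duhem_def)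
    \<comment> \<open>Subtracting the two conditions cancels the derivatives of the original
      potentials.\<close>
    ultimately have "(xA \<rho> / 2 + xA2 \<rho>) * (R * T * (c' / c \<rho>)) = 0"
      by (simp add: algebra_simps)
    moreover have "xA \<rho> / 2 + xA2 \<rho> > 0"
      using pos(1,2)[OF \<rho>] by simp
    ultimately have "c' = 0"
      using assms(1,2) c_pos[OF \<rho>] by simp
    with c' show ?thesis by simp
  qed
  \<comment> \<open>A vanishing derivative forces a constant because the interval is convex.\<close>
  have "\<exists>k. \<forall>\<rho>\<in>?I. c \<rho> = k"
    by (intro has_field_derivative_zero_constant has_field_derivative_at_within[OF c_const])
      simp_all
  then obtain k where k: "\<And>\<rho>. \<rho> \<in> ?I \<Longrightarrow> c \<rho> = k"
    by blast
  \<comment> \<open>The whole interval is a right neighbourhood of 0, so \<open>\<rho>max\<close>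
    itself serves as the bound; the value of \<open>c\<close> at 0 does not enter.\<close>
  have "eventually (\<lambda>\<rho>. c \<rho> = k) (at_right 0)"
    unfolding eventually_at_right_field using k assms(3) by (intro exI[of _ \<rho>max]) simp
  then have "(c \<longlongrightarrow> k) (at_right 0)"
    by (rule tendsto_eventually)
  with assms(18) have "k = 1"
    using tendsto_unique[OF trivial_limit_at_right_real] by blast
  with k show ?thesis by simp
qed

end
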